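(* Let $\Psi$ be a weighted directed graph with finite vertex set ${\tt N}$ and arc weights $\psi_{ij}$, let $\aleph$ be a partition of ${\tt N}$ by which $\Psi$ is tree-divisible, let $F'\in{\cal F}^k(\Psi|\aleph)$ and let $F$ be a minimal principal of $F'$. Let ${\tt X}\in\aleph$ contain no root of $F$, let $(x,y)$ be the unique arc of $F$ leaving ${\tt X}$ (i.e. $x\in{\tt X}$, $y\notin{\tt X}$), and let ${\tt Y}\in\aleph$ be the set containing $y$. Then $$f'_{\tt XY}=\psi^\aleph_{\tt XY}\ \ge\ \psi_{xy}=f^\aleph_{\tt XY}.$$ Moreover, equality holds when $F|_{\tt X}\in\tilde{\cal T}^\bullet_{\tt X}$.
   Context: An entering forest is a directed graph in which at most one arc leaves each vertex and there are no directed cycles; its components are entering trees, whose root is the unique vertex with no outgoing arc. ${\cal F}^k(G)$ is the set of spanning entering forests of $G$ with exactly $k$ trees. For a subgraph $G$ of $\Psi$ and ${\tt D}\subseteq{\tt N}$, $\Upsilon^G_{\tt D}=\sum_{(i,j)\in{\tt A}G,\ i\in{\tt D}}\psi_{ij}$, $\Upsilon^G=\Upsilon^G_{\tt N}$; $G|_{\tt D}$ is the induced subgraph. For a spanning subgraph $G$ of $\Psi$ and ${\tt D}\subseteq{\tt N}$: ${\cal T}^\bullet_{\tt D}(G)$ is the set of entering trees in $G$ with vertex set ${\tt D}$, $\lambda^\bullet_{\tt D}(G)=\min_{T\in{\cal T}^\bullet_{\tt D}(G)}\Upsilon^T$, and $\tilde{\cal T}^\bullet_{\tt D}(G)$ is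 the set of $T\in{\cal T}^\bullet_{\tt D}(G)$ with $\Upsilon^T=\lambda^\bullet_{\tt D}(G)$; ${\cal T}^\circ_{\tt D}(G)$ is the set of entering trees $T\subseteq G$ with ${\tt D}\subset{\tt V}T$, $|{\tt V}T|=|{\tt D}|+1$, $T|_{\tt D}\in{\cal T}^\bullet_{\tt D}(G)$. For distinct ${\tt X},{\tt Y}\in\aleph$, ${\cal T}_{\tt XY}(G)$ is the set of $T\in{\cal T}^\circ_{\tt X}(G)$ with root in ${\tt Y}$, $\lambda_{\tt XY}(G)=\min_{T\in{\cal T}_{\tt XY}(G)}\Upsilon^T$. When $G=\Psi$ the argument is omitted. $G$ is tree-divisible by $\aleph$ if ${\cal T}^\bullet_{\tt X}(G)\ne\emptyset$ for all ${\tt X}\in\aleph$. The splitting $G|\aleph=G^\aleph$ of a tree-divisible $G$ has vertex set $\aleph$ and an arc $({\tt X},{\tt Y})$, ${\tt X}\ne{\tt Y}$, iff ${\cal T}_{\tt XY}(G)\ne\emptyset$, of weight $\lambda_{\tt XY}(G)-\lambda^\bullet_{\tt X}(G)$; write $\psi^\aleph_{\tt XY}=\lambda_{\tt XY}-\lambda^\bullet_{\tt X}$ for the weights of $\Psi^\aleph$ and $f^\aleph_{\tt XY}=\lambda_{\tt XY}(F)-\lambda^\bullet_{\tt X}(F)$ for the weights of $F^\aleph$. A tree-divisible $F\in{\cal F}^k(\Psi)$ is a principal of a spanning entering forest $F'$ of $\Psi|\aleph$ if the arc set of $F'$ equals that of $F^\aleph$; arcs of $F'$ carry their weights in $\Psi^\aleph$,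 denoted $f'_{\tt XY}$. A minimal principal of $F'$ is a principal of minimal weight $\Upsilon^F$ among all principals of $F'$. *)

theory Defs
  imports
    "Graph_Theory.Graph_Theory"
    "Graph_Theory.Weighted_Graph"
    "HOL-Library.Disjoint_Sets"
begin

text \<open>Arcs are ordered pairs of vertices: the ambient graph is a \<^typ>\<open>'v pair_pre_digraph\<close>, and its
  subgraphs live in \<^typ>\<open>('v, 'v \<times> 'v) pre_digraph\<close>, where \<^const>\<open>subgraph\<close> forces tail and head
  to be the two projections. Weights are kept apart from the graphs, so that all subgraphs of a graph
  share its weight function.\<close>

definition entering_forest :: "('v, 'a) pre_digraph \<Rightarrow> bool" where
  "entering_forest G \<longleftrightarrow>
     fin_digraph G \<and> (\<forall>v \<in> verts G. out_degree G v \<le> 1) \<and> forest G"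

definition entering_tree :: "('v, 'a) pre_digraph \<Rightarrow> bool" where
  "entering_tree G \<longleftrightarrow> entering_forest G \<and> Digraph_Component.connected G"

definition is_root :: "('v, 'a) pre_digraph \<Rightarrow> 'v \<Rightarrow> bool" where
  "is_root G v \<longleftrightarrow> v \<in> verts G \<and> out_arcs G v = {}"

text \<open>Connectedness in \<open>Graph_Theory\<close> ignores the direction of arcs, so these are the weak
  components.\<close>

definition components :: "('v, 'a) pre_digraph \<Rightarrow> ('v, 'a) pre_digraph set" where
  "components G = {C. pre_digraph.max_subgraph G Digraph_Component.connected C}"

definition spanning_forests :: "nat \<Rightarrow> ('v, 'a) pre_digraph \<Rightarrow> ('v, 'a) pre_digraph set" where
  "spanning_forests k G = {F. spanning F G \<and> entering_forest F \<and> card (components F) = k}"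

definition weight :: "'a weight_fun \<Rightarrow> ('v, 'a) pre_digraph \<Rightarrow> real" where
  "weight \<psi> G = (\<Sum>a \<in> arcs G. \<psi> a)"

text \<open>The sets \<open>\<T>\<^sup>\<bullet>\<^sub>D(G)\<close>, the minimum \<open>\<lambda>\<^sup>\<bullet>\<^sub>D(G)\<close>, and the trees attaining it.\<close>

definition trees_on :: "('v, 'a) pre_digraph \<Rightarrow> 'v set \<Rightarrow> ('v, 'a) pre_digraph set" where
  "trees_on G D = {T. subgraph T G \<and> entering_tree T \<and> verts T = D}"

definition min_weight_on :: "'a weight_fun \<Rightarrow> ('v, 'a) pre_digraph \<Rightarrow> 'v set \<Rightarrow> real" where
  "min_weight_on \<psi> G D = Min (weight \<psi> ` trees_on G D)"

definition min_trees_on ::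
    "'a weight_fun \<Rightarrow> ('v, 'a) pre_digraph \<Rightarrow> 'v set \<Rightarrow> ('v, 'a) pre_digraph set" where
  "min_trees_on \<psi> G D = {T \<in> trees_on G D. weight \<psi> T = min_weight_on \<psi> G D}"

text \<open>The sets \<open>\<T>\<^sup>\<circ>\<^sub>D(G)\<close> and \<open>\<T>\<^sub>X\<^sub>Y(G)\<close>, and the minimum \<open>\<lambda>\<^sub>X\<^sub>Y(G)\<close>.\<close>

definition trees_around :: "('v, 'a) pre_digraph \<Rightarrow> 'v set \<Rightarrow> ('v, 'a) pre_digraph set" where
  "trees_around G D = {T. subgraph T G \<and> entering_tree T \<and> D \<subset> verts T \<and>
     card (verts T) = card D + 1 \<and> T \<restriction> D \<in> trees_on G D}"

definition trees_between ::
    "('v, 'a) pre_digraph \<Rightarrow> 'v set \<Rightarrow> 'v set \<Rightarrow> ('v, 'a) pre_digraph set" where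
  "trees_between G X Y = {T \<in> trees_around G X. \<exists>r \<in> Y. is_root T r}"

definition min_weight_between ::
    "'a weight_fun \<Rightarrow> ('v, 'a) pre_digraph \<Rightarrow> 'v set \<Rightarrow> 'v set \<Rightarrow> real" where
  "min_weight_between \<psi> G X Y = Min (weight \<psi> ` trees_between G X Y)"

definition tree_divisible :: "('v, 'a) pre_digraph \<Rightarrow> 'v set set \<Rightarrow> bool" where
  "tree_divisible G P \<longleftrightarrow> (\<forall>X \<in> P. trees_on G X \<noteq> {})"

definition splitting :: "('v, 'a) pre_digraph \<Rightarrow> 'v set set \<Rightarrow> 'v set pair_pre_digraph" where
  "splitting G P = \<lparr> pverts = P,
     parcs = {(X, Y). X \<in> P \<and> Y \<in> P \<and> X \<noteq> Y \<and> trees_between G X Y \<noteq> {}} \<rparr>"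

text \<open>Meaningful on the arcs of the splitting only; elsewhere the minima may range over the empty
  set.\<close>

definition splitting_weight ::
    "'a weight_fun \<Rightarrow> ('v, 'a) pre_digraph \<Rightarrow> ('v set \<times> 'v set) weight_fun" where
  "splitting_weight \<psi> G = (\<lambda>(X, Y). min_weight_between \<psi> G X Y - min_weight_on \<psi> G X)"

definition principal ::
    "('v, 'a) pre_digraph \<Rightarrow> 'v set set \<Rightarrow> nat \<Rightarrow>
     ('v set, 'v set \<times> 'v set) pre_digraph \<Rightarrow> ('v, 'a) pre_digraph \<Rightarrow> bool" where
  "principal G P k F' F \<longleftrightarrow>
     F \<in> spanning_forests k G \<and> tree_divisible F P \<and> arcs F' = parcs (splitting F P)"

definition minimal_principal ::
    "'a weight_fun \<Rightarrow> ('v, 'a) pre_digraph \<Rightarrow> 'v set set \<Rightarrow> nat \<Rightarrow>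
     ('v set, 'v set \<times> 'v set) pre_digraph \<Rightarrow> ('v, 'a) pre_digraph \<Rightarrow> bool" where
  "minimal_principal \<psi> G P k F' F \<longleftrightarrow>
     principal G P k F' F \<and> (\<forall>H. principal G P k F' H \<longrightarrow> weight \<psi> F \<le> weight \<psi> H)"

end

theory Submission
  imports Defs
begin

text \<open>An entering forest \<open>F\<close> that is tree-divisible by \<open>P\<close> induces a unique tree on each block, and
  only the root of that tree can have an arc leaving the block. Hence the trees of \<open>F\<close> on and
  around \<open>X\<close> are determined, which gives \<open>\<psi>\<^sub>x\<^sub>y = f\<^sup>\<aleph>\<^sub>X\<^sub>Y\<close>. For the inequality, replace all
  arcs of \<open>F\<close> leaving vertices of \<open>X\<close> by a tree of weight \<open>\<lambda>\<^sub>X\<^sub>Y\<close>. Since \<open>F'\<close> is acyclic and each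
  block carries a tree, the result is acyclic; its roots are those of \<open>F\<close>, so it has as many
  components, and it is again a principal of \<open>F'\<close>. Minimality of \<open>F\<close> yields
  \<open>\<Upsilon>(F|\<^sub>X) + \<psi>\<^sub>x\<^sub>y \<le> \<lambda>\<^sub>X\<^sub>Y\<close>, while \<open>\<lambda>\<^sup>\<bullet>\<^sub>X \<le> \<Upsilon>(F|\<^sub>X)\<close>, with equality when \<open>F|\<^sub>X\<close> is a minimal tree.\<close>

section \<open>Entering forests\<close>

text \<open>A nonempty closed walk contains a cycle, and a cycle is itself such a walk. This trades
  arc lists for reasoning about transitive closures.\<close>

lemma (in wf_digraph) forest_iff_acyclic: "forest G \<longleftrightarrow> acyclic (arcs_ends G)"
proof
  assume "forest G"
  then show "acyclic (arcs_ends G)"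
    unfolding forest_def acyclic_def reachable1_awalk
    using closed_w_imp_cycle closed_w_def by blast
next
  assume "acyclic (arcs_ends G)"
  then show "forest G"
    unfolding forest_def acyclic_def reachable1_awalk cycle_def by blast
qed

lemma entering_forest_fin: "entering_forest G \<Longrightarrow> fin_digraph G"
  by (simp add: entering_forest_def)

lemma entering_forest_acyclic: "entering_forest G \<Longrightarrow> acyclic (arcs_ends G)"
  using wf_digraph.forest_iff_acyclic by (auto simp: entering_forest_def fin_digraph_def)

lemma entering_forest_arc_unique:
  assumes "entering_forest G" "a \<in> arcs G" "b \<in> arcs G" "tail G a = tail G b"
  shows "a = b"
proof -
  interpret fin_digraph G using assms(1) by (rule entering_forest_fin)
  have "out_degree G (tail G a) \<le> 1" using assms by (simp add: entering_forest_def)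
  moreover have "a \<in> out_arcs G (tail G a)" "b \<in> out_arcs G (tail G a)" using assms by auto
  ultimately show ?thesis
    unfolding out_degree_def using finite_out_arcs[of "tail G a"]
    by (metis card_le_Suc0_iff_eq One_nat_def)
qed

lemma entering_forest_single_valued:
  assumes "entering_forest G" shows "single_valued (arcs_ends G)"
  using entering_forest_arc_unique[OF assms]
  by (fastforce simp: single_valued_def arcs_ends_conv)

lemma entering_forestI:
  assumes "fin_digraph G" "\<And>a b. a \<in> arcs G \<Longrightarrow> b \<in> arcs G \<Longrightarrow> tail G a = tail G b \<Longrightarrow> a = b"
    and "acyclic (arcs_ends G)"
  shows "entering_forest G"
proof -
  interpret fin_digraph G by fact
  have "out_degree G v \<le> 1" for v
    unfolding out_degree_def using assms(2) finite_out_arcs[of v]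
    by (auto simp: card_le_Suc0_iff_eq)
  then show ?thesis using assms by (simp add: entering_forest_def forest_iff_acyclic)
qed

section \<open>Roots and directed reachability\<close>

lemma is_root_iff: "is_root G v \<longleftrightarrow> v \<in> verts G \<and> v \<notin> Domain (arcs_ends G)"
  by (fastforce simp: is_root_def arcs_ends_conv out_arcs_def)

lemma is_root_rtrancl: "is_root G r \<Longrightarrow> (r, v) \<in> (arcs_ends G)\<^sup>* \<Longrightarrow> v = r"
  by (auto simp: is_root_iff elim: converse_rtranclE)

lemma (in wf_digraph) rtrancl_in_verts:
  "(u, v) \<in> (arcs_ends G)\<^sup>* \<Longrightarrow> v \<in> verts G \<Longrightarrow> u \<in> verts G"
  by (induction rule: converse_rtrancl_induct) (auto dest: adj_in_verts)

text \<open>Follow outgoing arcs: finiteness and acyclicity make the converse arc relation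
  well-founded, so the walk stops, and it can stop only at a root.\<close>

lemma entering_forest_reaches_root:
  assumes "entering_forest G" "v \<in> verts G"
  shows "\<exists>r. is_root G r \<and> (v, r) \<in> (arcs_ends G)\<^sup>*"
proof -
  interpret fin_digraph G using assms(1) by (rule entering_forest_fin)
  have "finite (arcs_ends G)" by (simp add: arcs_ends_def)
  then have "wf ((arcs_ends G)\<inverse>)"
    using entering_forest_acyclic[OF assms(1)] by (rule finite_acyclic_wf_converse)
  then show ?thesis using assms(2)
  proof (induction v rule: wf_induct_rule)
    case (less v)
    show ?case
    proof (cases "is_root G v")
      case False
      then obtain w where w: "(v, w) \<in> arcs_ends G" using less.prems by (auto simp: is_root_iff)
      then show ?thesis
        using less.IH[of w] adj_in_verts by (blast intro: converse_rtrancl_into_rtrancl)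
    qed auto
  qed
qed

text \<open>Reaching \<open>r\<close> survives an arc traversed in either direction. Backwards, the
  arc is prepended to the path. Forwards along \<open>(a, b)\<close>, \<open>a\<close> is not the
  root, so its path to \<open>r\<close> is nonempty and must begin with its only outgoing
  arc.\<close>

lemma entering_forest_connected_root:
  assumes "entering_forest G" "is_root G r" "(u, r) \<in> (arcs_ends G)\<^sup>*"
    and "(u, v) \<in> ((arcs_ends G)\<^sup>s)\<^sup>*"
  shows "(v, r) \<in> (arcs_ends G)\<^sup>*"
  using assms(4)
proof (induction rule: rtrancl_induct)
  case base
  show ?case by fact
next
  case (step a b)
  then consider "(a, b) \<in> arcs_ends G" | "(b, a) \<in> arcs_ends G" by (auto simp: symcl_def)
  then show ?case
  proof cases
    case 1
    with step.IH assms(2) have "(a, r) \<in> (arcs_ends G)\<^sup>+"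
      by (auto simp: is_root_iff rtrancl_eq_or_trancl)
    then show ?thesis
      using 1 entering_forest_single_valued[OF assms(1)]
      by (metis single_valuedD tranclD)
  next
    case 2
    then show ?thesis using step.IH by (blast intro: converse_rtrancl_into_rtrancl)
  qed
qed

text \<open>Connectedness means strong connectedness of the symmetrised graph, where every path to
  \<open>r\<close> can also be run backwards.\<close>

lemma (in wf_digraph) connected_if_reaches:
  assumes "r \<in> verts G" "\<And>v. v \<in> verts G \<Longrightarrow> (v, r) \<in> (arcs_ends G)\<^sup>*"
  shows "Digraph_Component.connected G"
proof -
  interpret S: pair_wf_digraph "mk_symmetric G" by (rule wellformed_mk_symmetric)
  have "v \<rightarrow>\<^sup>*\<^bsub>mk_symmetric G\<^esub> r" "r \<rightarrow>\<^sup>*\<^bsub>mk_symmetric G\<^esub> v" if "v \<in> verts G" for v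
    using that assms reachable_mk_symmetricI symmetric_mk_symmetric symmetric_reachable
      reachable_conv' by metis+
  then show ?thesis
    unfolding connected_def using assms(1) S.reachable_trans
    by (intro strongly_connectedI) (auto, blast)
qed

text \<open>Replaces undirected connectedness by directed paths to one root, the form in which trees
  are recognised and built below.\<close>

lemma entering_tree_iff:
  "entering_tree G \<longleftrightarrow>
    entering_forest G \<and> (\<exists>r. is_root G r \<and> (\<forall>v \<in> verts G. (v, r) \<in> (arcs_ends G)\<^sup>*))"
proof
  assume t: "entering_tree G"
  then have f: "entering_forest G" and c: "Digraph_Component.connected G"
    by (auto simp: entering_tree_def)
  then obtain v where v: "v \<in> verts G" by (auto simp: connected_conv)
  obtain r where r: "is_root G r" "(v, r) \<in> (arcs_ends G)\<^sup>*"
    using entering_forest_reaches_root[OF f v] by blast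
  have "(u, r) \<in> (arcs_ends G)\<^sup>*" if "u \<in> verts G" for u
  proof (rule entering_forest_connected_root[OF f r])
    show "(v, u) \<in> ((arcs_ends G)\<^sup>s)\<^sup>*"
      using c v that unfolding connected_conv by (blast dest: rtrancl_on_rtranclI)
  qed
  with f r show "entering_forest G \<and> (\<exists>r. is_root G r \<and> (\<forall>v \<in> verts G. (v, r) \<in> (arcs_ends G)\<^sup>*))"
    by blast
next
  assume a: "entering_forest G \<and> (\<exists>r. is_root G r \<and> (\<forall>v \<in> verts G. (v, r) \<in> (arcs_ends G)\<^sup>*))"
  then interpret fin_digraph G by (blast intro: entering_forest_fin)
  from a show "entering_tree G"
    using connected_if_reaches by (auto simp: entering_tree_def is_root_def)
qed

section \<open>Counting components by roots\<close>

lemma pre_digraph_eqI: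
  fixes G H :: "('v, 'a) pre_digraph"
  assumes "verts G = verts H" "arcs G = arcs H" "compatible G H"
  shows "G = H"
  using assms by (simp add: compatible_def)

text \<open>The weak components are the subgraphs induced on the basins \<open>S r\<close> of
  vertices that reach a root \<open>r\<close>. Comparing numbers of trees thus reduces to comparing
  roots.\<close>

theorem card_components_entering_forest:
  assumes "entering_forest G"
  shows "card (components G) = card {r. is_root G r}"
proof -
  interpret fin_digraph G using assms by (rule entering_forest_fin)
  define S where "S r = {v. (v, r) \<in> (arcs_ends G)\<^sup>*}" for r
  have S_sub: "S r \<subseteq> verts G" if "is_root G r" for r
    using that rtrancl_in_verts by (auto simp: S_def is_root_def)
  have sub: "subgraph (G \<restriction> S r) G" if "is_root G r" for r
    using S_sub[OF that] by (blast intro: induced_imp_subgraph)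
  have conn: "Digraph_Component.connected (G \<restriction> S r)" if r: "is_root G r" for r
  proof -
    interpret I: wf_digraph "G \<restriction> S r" using sub[OF r] by blast
    show ?thesis
    proof (rule I.connected_if_reaches[of r])
      show "r \<in> verts (G \<restriction> S r)" by (simp add: S_def)
      fix v assume "v \<in> verts (G \<restriction> S r)"
      then have "(v, r) \<in> (arcs_ends G)\<^sup>*" by (simp add: S_def)
      then show "(v, r) \<in> (arcs_ends (G \<restriction> S r))\<^sup>*"
      proof (induction rule: converse_rtrancl_induct)
        case (step a b)
        then have "a \<in> S r" "b \<in> S r" by (auto simp: S_def)
        then have "(a, b) \<in> arcs_ends (G \<restriction> S r)" using step(1) by (auto simp: arcs_ends_conv)
        then show ?case using step.IH by (blast intro: converse_rtrancl_into_rtrancl)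
      qed auto
    qed
  qed
  \<comment> \<open>A connected subgraph that meets a basin cannot leave it, because undirected
    steps preserve reaching \<open>r\<close>; this makes the induced subgraph on a basin
    maximal.\<close>
  have verts_sub: "verts C \<subseteq> S r"
    if C: "subgraph C G" "Digraph_Component.connected C" and r: "is_root G r"
      and v: "v \<in> verts C" "v \<in> S r" for C r v
  proof
    fix u assume "u \<in> verts C"
    then have "(v, u) \<in> ((arcs_ends C)\<^sup>s)\<^sup>*"
      using C(2) v(1) by (auto simp: connected_conv intro: rtrancl_on_rtranclI)
    moreover have "(arcs_ends C)\<^sup>s \<subseteq> (arcs_ends G)\<^sup>s"
      using arcs_ends_mono[OF C(1)] by (auto simp: symcl_def)
    ultimately have "(v, u) \<in> ((arcs_ends G)\<^sup>s)\<^sup>*" using rtrancl_mono by blast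
    then show "u \<in> S r"
      using entering_forest_connected_root[OF assms r] v(2) by (auto simp: S_def)
  qed
  have sub_ind: "subgraph C (G \<restriction> S r)"
    if C: "subgraph C G" and s: "verts C \<subseteq> S r" for C r
    using C s by (auto simp: subgraph_def compatible_def wf_digraph.wellformed)
  have "bij_betw (\<lambda>r. G \<restriction> S r) {r. is_root G r} (components G)"
    unfolding bij_betw_def
  proof
    \<comment> \<open>Each root lies in its own basin, and a root reaches nothing but itself, so
      different roots have different basins.\<close>
    show "inj_on (\<lambda>r. G \<restriction> S r) {r. is_root G r}"
    proof (rule inj_onI)
      fix r s assume rs: "r \<in> {r. is_root G r}" "s \<in> {r. is_root G r}" "G \<restriction> S r = G \<restriction> S s"
      then have "S r = S s" by (metis induce_subgraph_verts)
      then have "(r, s) \<in> (arcs_ends G)\<^sup>*" by (auto simp: S_def)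
      with rs show "r = s" using is_root_rtrancl by fastforce
    qed
    show "(\<lambda>r. G \<restriction> S r) ` {r. is_root G r} = components G"
    proof (intro equalityI subsetI)
      fix C assume "C \<in> (\<lambda>r. G \<restriction> S r) ` {r. is_root G r}"
      then obtain r where r: "is_root G r" and C: "C = G \<restriction> S r" by blast
      have "H = C" if H: "subgraph C H" "subgraph H G" "Digraph_Component.connected H" for H
      proof -
        have "r \<in> verts H" using H(1) C by (auto simp: subgraph_def S_def)
        then have "verts H \<subseteq> S r" by (intro verts_sub[OF H(2,3) r]) (auto simp: S_def)
        then have "subgraph H C" unfolding C by (intro sub_ind H)
        with H(1) show ?thesis by (intro pre_digraph_eqI) (auto simp: subgraph_def)
      qed
      then show "C \<in> components G"
        unfolding components_def max_subgraph_def using sub[OF r] conn[OF r] C by auto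
    next
      fix C assume "C \<in> components G"
      then have C: "subgraph C G" "Digraph_Component.connected C"
        and mx: "\<And>H. H \<noteq> C \<Longrightarrow> subgraph C H \<Longrightarrow> subgraph H G \<Longrightarrow> \<not> Digraph_Component.connected H"
        unfolding components_def max_subgraph_def by auto
      obtain v where v: "v \<in> verts C" using C by (auto simp: connected_conv)
      then have "v \<in> verts G" using C by (auto simp: subgraph_def)
      then obtain r where r: "is_root G r" "v \<in> S r"
        using entering_forest_reaches_root[OF assms] by (auto simp: S_def)
      \<comment> \<open>\<open>C\<close> lies in the connected subgraph on a basin, so maximality of
        \<open>C\<close> forces equality.\<close>
      have "subgraph C (G \<restriction> S r)" using sub_ind verts_sub C r v by blast
      then have "C = G \<restriction> S r" using mx[of "G \<restriction> S r"] sub[OF r(1)] conn[OF r(1)] by metis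
      with r show "C \<in> (\<lambda>r. G \<restriction> S r) ` {r. is_root G r}" by blast
    qed
  qed
  then show ?thesis by (metis bij_betw_same_card)
qed

section \<open>Trees on and around a vertex set\<close>

text \<open>A subgraph inherits \<open>tail\<close> and \<open>head\<close>, so its vertex set and
  arc set determine it. The resulting finiteness makes each \<open>Min\<close> over a nonempty set
  of trees an attained minimum.\<close>

lemma finite_subgraphs:
  fixes G :: "('v, 'a) pre_digraph"
  assumes "fin_digraph G"
  shows "finite {H. subgraph H G}"
proof (rule finite_subset)
  interpret fin_digraph G by fact
  let ?mk = "\<lambda>(V, A). \<lparr>verts = V, arcs = A, tail = tail G, head = head G\<rparr>"
  show "{H. subgraph H G} \<subseteq> ?mk ` (Pow (verts G) \<times> Pow (arcs G))"
  proof
    fix H assume "H \<in> {H. subgraph H G}"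
    then have "H = ?mk (verts H, arcs H)" "(verts H, arcs H) \<in> Pow (verts G) \<times> Pow (arcs G)"
      by (auto simp: subgraph_def compatible_def)
    then show "H \<in> ?mk ` (Pow (verts G) \<times> Pow (arcs G))" by blast
  qed
  show "finite (?mk ` (Pow (verts G) \<times> Pow (arcs G)))" by simp
qed

lemma finite_trees_on: "fin_digraph G \<Longrightarrow> finite (trees_on G D)"
  by (rule finite_subset[OF _ finite_subgraphs]) (auto simp: trees_on_def)

lemma finite_trees_between: "fin_digraph G \<Longrightarrow> finite (trees_between G X Y)"
  by (rule finite_subset[OF _ finite_subgraphs]) (auto simp: trees_between_def trees_around_def)

lemma trees_on_mono: "subgraph H G \<Longrightarrow> trees_on H D \<subseteq> trees_on G D"
  by (auto simp: trees_on_def intro: subgraph_trans)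

lemma trees_between_mono: "subgraph H G \<Longrightarrow> trees_between H X Y \<subseteq> trees_between G X Y"
  using trees_on_mono[of H G X]
  by (auto simp: trees_between_def trees_around_def intro: subgraph_trans)

section \<open>Trees on a vertex set and their uniqueness in a forest\<close>

lemma trees_onD:
  assumes "T \<in> trees_on G D"
  shows "subgraph T G" "entering_forest T" "verts T = D" "tail T = tail G" "head T = head G"
    "arcs T \<subseteq> arcs G" "finite D" "finite (arcs T)"
    "\<And>b. b \<in> arcs T \<Longrightarrow> tail G b \<in> D \<and> head G b \<in> D"
proof -
  show *: "subgraph T G" "entering_forest T" "verts T = D"
    using assms by (auto simp: trees_on_def entering_tree_def)
  then show **: "tail T = tail G" "head T = head G" "arcs T \<subseteq> arcs G"
    by (auto simp: subgraph_def compatible_def)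
  interpret T: fin_digraph T using *(2) by (rule entering_forest_fin)
  show "finite D" "finite (arcs T)" using T.finite_verts * by auto
  show "\<And>b. b \<in> arcs T \<Longrightarrow> tail G b \<in> D \<and> head G b \<in> D"
    using T.wellformed * ** by auto
qed

lemma trees_on_root:
  assumes "T \<in> trees_on G D"
  obtains r where "r \<in> D" "is_root T r" "\<And>v. v \<in> D \<Longrightarrow> (v, r) \<in> (arcs_ends T)\<^sup>*"
proof -
  have "entering_tree T" "verts T = D" using assms by (auto simp: trees_on_def)
  then obtain r where "is_root T r" "\<forall>v \<in> D. (v, r) \<in> (arcs_ends T)\<^sup>*"
    unfolding entering_tree_iff by blast
  moreover then have "r \<in> D" using \<open>verts T = D\<close> by (auto simp: is_root_def)
  ultimately show ?thesis using that by blast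
qed

text \<open>The root supplied by \<open>trees_on_root\<close> is reached from \<open>u\<close>, and
  a root reaches only itself, so the two coincide.\<close>

lemma trees_on_root_reached:
  assumes "T \<in> trees_on G D" "is_root T u" "v \<in> D"
  shows "(v, u) \<in> (arcs_ends T)\<^sup>*"
proof -
  obtain r where r: "r \<in> D" "is_root T r" "\<And>v. v \<in> D \<Longrightarrow> (v, r) \<in> (arcs_ends T)\<^sup>*"
    using trees_on_root[OF assms(1)] by blast
  have "u \<in> D" using assms(2) trees_onD(3)[OF assms(1)] by (auto simp: is_root_def)
  then have "r = u" using r is_root_rtrancl[OF assms(2)] by blast
  with r assms(3) show ?thesis by blast
qed

lemma trees_on_nonroot:
  assumes "T \<in> trees_on G D" "v \<in> D" "\<not> is_root T v"
  obtains b where "b \<in> arcs T" "tail G b = v" "head G b \<in> D"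
proof -
  note T = trees_onD[OF assms(1)]
  obtain b where "b \<in> arcs T" "tail G b = v"
    using assms(2,3) T(3,4) by (fastforce simp: is_root_def)
  then show ?thesis using that T(9) by blast
qed

text \<open>A nonroot of \<open>T\<close> already spends its single arc of \<open>F\<close> inside
  \<open>D\<close>.\<close>

lemma trees_on_leaving_arc_root:
  assumes "entering_forest F" "T \<in> trees_on F D" "a \<in> arcs F" "tail F a \<in> D" "head F a \<notin> D"
  shows "is_root T (tail F a)"
proof (rule ccontr)
  assume "\<not> is_root T (tail F a)"
  then obtain b where b: "b \<in> arcs T" "tail F b = tail F a" "head F b \<in> D"
    using trees_on_nonroot[OF assms(2,4)] by blast
  then have "b = a"
    using entering_forest_arc_unique[OF assms(1)] assms(3) trees_onD(6)[OF assms(2)] by blast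
  with b assms(5) show False by simp
qed

text \<open>No arc of \<open>F\<close> inside \<open>D\<close> can be missing from \<open>T\<close>:
  a nonroot has its only outgoing arc in \<open>T\<close>, and an arc from the root would close a
  cycle with the tree path back.\<close>

lemma trees_on_entering_forest:
  assumes "entering_forest F" "T \<in> trees_on F D"
  shows "T = F \<restriction> D"
proof (rule pre_digraph_eqI)
  note T = trees_onD[OF assms(2)]
  show "verts T = verts (F \<restriction> D)" "compatible T (F \<restriction> D)"
    using T by (auto simp: compatible_def)
  show "arcs T = arcs (F \<restriction> D)"
  proof (intro equalityI subsetI)
    fix b assume b: "b \<in> arcs (F \<restriction> D)"
    show "b \<in> arcs T"
    proof (cases "is_root T (tail F b)")
      case True
      then have "(head F b, tail F b) \<in> (arcs_ends T)\<^sup>*"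
        using trees_on_root_reached[OF assms(2)] b by simp
      then have "(head F b, tail F b) \<in> (arcs_ends F)\<^sup>*"
        using arcs_ends_mono[OF T(1)] rtrancl_mono by blast
      moreover have "(tail F b, head F b) \<in> arcs_ends F" using b by (auto simp: arcs_ends_conv)
      ultimately have "(tail F b, tail F b) \<in> (arcs_ends F)\<^sup>+" by (rule rtrancl_into_trancl2[rotated])
      then show ?thesis using entering_forest_acyclic[OF assms(1)] by (auto simp: acyclic_def)
    next
      case False
      then obtain c where "c \<in> arcs T" "tail F c = tail F b"
        using trees_on_nonroot[OF assms(2)] b by auto
      then show ?thesis
        using entering_forest_arc_unique[OF assms(1), of c b] b T by auto
    qed
  qed (use T in auto)
qed

lemma trees_on_entering_forest_singleton:
  "entering_forest F \<Longrightarrow> T \<in> trees_on F D \<Longrightarrow> trees_on F D = {T}"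
  using trees_on_entering_forest by blast

section \<open>Trees between two sets: a tree on the first plus one arc\<close>

lemma trees_between_decompose:
  assumes "T \<in> trees_between G X Y" "X \<inter> Y = {}"
  obtains a where "a \<in> arcs G" "tail G a \<in> X" "head G a \<in> Y" "verts T = insert (head G a) X"
    "arcs T = insert a (arcs (T \<restriction> X))" "T \<restriction> X \<in> trees_on G X" "is_root (T \<restriction> X) (tail G a)"
proof -
  have T: "subgraph T G" "entering_forest T" "X \<subset> verts T" "card (verts T) = card X + 1"
    and R: "T \<restriction> X \<in> trees_on G X"
    using assms(1) by (auto simp: trees_between_def trees_around_def entering_tree_def)
  obtain z where z: "z \<in> Y" "is_root T z" using assms(1) by (auto simp: trees_between_def)
  interpret T: fin_digraph T using T(2) by (rule entering_forest_fin)
  have th: "tail T = tail G" "head T = head G" "arcs T \<subseteq> arcs G"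
    using T(1) by (auto simp: subgraph_def compatible_def)
  have zX: "z \<notin> X" "z \<in> verts T" using z assms(2) by (auto simp: is_root_def)
  \<comment> \<open>The cardinality condition leaves room for one vertex besides \<open>X\<close>,
    and the root \<open>z\<close> is such a vertex.\<close>
  have V: "verts T = insert z X"
  proof (rule sym, rule card_subset_eq)
    show "finite (verts T)" "insert z X \<subseteq> verts T" using T(3) zX by auto
    show "card (insert z X) = card (verts T)"
      using T(4) zX trees_onD(7)[OF R] by simp
  qed
  obtain u where u: "u \<in> X" "is_root (T \<restriction> X) u" using trees_on_root[OF R] by blast
  have out_u: "head G b = z" if "b \<in> arcs T" "tail G b = u" for b
  proof -
    have "head G b \<in> insert z X" using T.head_in_verts[OF that(1)] V th by simp
    moreover have "head G b \<notin> X" using u that th by (auto simp: is_root_def out_arcs_def)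
    ultimately show ?thesis by simp
  qed
  \<comment> \<open>Otherwise \<open>T\<close> would have the two roots \<open>u\<close> and
    \<open>z\<close>. So \<open>u\<close> has an outgoing arc, which by \<open>out_u\<close> ends in
    \<open>z\<close>.\<close>
  have "\<not> is_root T u"
  proof
    assume "is_root T u"
    moreover obtain r where r: "is_root T r" "\<forall>v \<in> verts T. (v, r) \<in> (arcs_ends T)\<^sup>*"
      using assms(1) unfolding trees_between_def trees_around_def entering_tree_iff by blast
    ultimately have "r = u" "r = z"
      using is_root_rtrancl[of T u r] is_root_rtrancl[of T z r] z V u by auto
    then show False using u zX by simp
  qed
  then obtain a where a: "a \<in> arcs T" "tail G a = u" using u V th by (fastforce simp: is_root_def)
  have hd_a: "head G a = z" using out_u a by blast
  \<comment> \<open>An arc starting at \<open>u\<close> is \<open>a\<close>; any other vertex of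
    \<open>X\<close> has its only outgoing arc inside \<open>X\<close>.\<close>
  have "b \<in> insert a (arcs (T \<restriction> X))" if b: "b \<in> arcs T" for b
  proof -
    have "tail G b \<noteq> z" using z b th by (auto simp: is_root_def out_arcs_def)
    then have tX: "tail G b \<in> X" using T.tail_in_verts[OF b] V th by simp
    show ?thesis
    proof (cases "is_root (T \<restriction> X) (tail G b)")
      case True
      then have "(u, tail G b) \<in> (arcs_ends (T \<restriction> X))\<^sup>*"
        using trees_on_root_reached[OF R] u by blast
      then have "tail G b = u" using is_root_rtrancl[OF u(2)] by blast
      then show ?thesis using entering_forest_arc_unique[OF T(2) a(1) b] a th by simp
    next
      case False
      then obtain c where "c \<in> arcs (T \<restriction> X)" "tail G c = tail G b"
        using trees_on_nonroot[OF R tX] by blast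
      then show ?thesis using entering_forest_arc_unique[OF T(2) _ b, of c] th by auto
    qed
  qed
  then have "arcs T = insert a (arcs (T \<restriction> X))" using a by auto
  then show ?thesis using that[of a] a u hd_a z V R th by auto
qed

lemma weight_trees_between:
  assumes "T \<in> trees_on G X" "is_root T (tail G a)" "arcs T' = insert a (arcs T)"
  shows "weight \<psi> T' = weight \<psi> T + \<psi> a"
proof -
  have "a \<notin> arcs T" using assms(2) trees_onD(4)[OF assms(1)] by (auto simp: is_root_def out_arcs_def)
  then show ?thesis using assms(3) trees_onD(8)[OF assms(1)] by (simp add: weight_def)
qed

text \<open>Converse of \<open>trees_between_decompose\<close>: the root of \<open>T\<close> gets an
  arc to a fresh vertex, which becomes the new root.\<close>

lemma trees_between_extend:
  assumes "T \<in> trees_on G X" "a \<in> arcs G" "is_root T (tail G a)" "head G a \<in> Y" "head G a \<notin> X"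
  shows "\<lparr>verts = insert (head G a) X, arcs = insert a (arcs T), tail = tail G, head = head G\<rparr>
    \<in> trees_between G X Y" (is "?T \<in> _")
proof -
  note T = trees_onD[OF assms(1)]
  let ?u = "tail G a" and ?z = "head G a"
  have u: "?u \<in> X" using assms(3) T(3) by (auto simp: is_root_def)
  interpret G: wf_digraph G using T(1) by (auto simp: subgraph_def)
  have XG: "X \<subseteq> verts G" using T(1,3) by (auto simp: subgraph_def)
  have ends: "arcs_ends ?T = insert (?u, ?z) (arcs_ends T)"
    using T(4,5) by (auto simp: arcs_ends_conv)
  have fin: "fin_digraph ?T"
    using T(7,8,9) u by unfold_locales auto
  then interpret T': fin_digraph ?T .
  have sub: "subgraph ?T G"
    using XG G.head_in_verts[OF assms(2)] T(6) assms(2)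
    by (intro subgraphI T'.wf_digraph G.wf_digraph) (auto simp: compatible_def)
  have no_out_u: "tail G b \<noteq> ?u" if "b \<in> arcs T" for b
    using that assms(3) T(4) by (auto simp: is_root_def out_arcs_def)
  have forest: "entering_forest ?T"
  proof (rule entering_forestI[OF fin])
    show "b = c" if "b \<in> arcs ?T" "c \<in> arcs ?T" "tail ?T b = tail ?T c" for b c
      using that no_out_u entering_forest_arc_unique[OF T(2)] T(4) by auto metis+
    \<comment> \<open>Inserting one arc keeps a relation acyclic if no path leads back from its
      head; here \<open>?z\<close> lies outside \<open>X\<close>, where \<open>T\<close> has no
      arcs.\<close>
    have "(?z, ?u) \<notin> (arcs_ends T)\<^sup>*"
    proof
      assume "(?z, ?u) \<in> (arcs_ends T)\<^sup>*"
      moreover have "?z \<noteq> ?u" using u assms(5) by auto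
      ultimately obtain w where "(?z, w) \<in> arcs_ends T" by (metis converse_rtranclE)
      then show False using T(4,9) assms(5) by (auto simp: arcs_ends_conv)
    qed
    then show "acyclic (arcs_ends ?T)"
      using entering_forest_acyclic[OF T(2)] unfolding ends by simp
  qed
  have z_root: "is_root ?T ?z"
    using T(9) u assms(5) by (fastforce simp: is_root_def)
  have "(v, ?z) \<in> (arcs_ends ?T)\<^sup>*" if "v \<in> verts ?T" for v
  proof (cases "v \<in> X")
    case True
    then have "(v, ?u) \<in> (arcs_ends T)\<^sup>*" using trees_on_root_reached[OF assms(1,3)] by blast
    then have "(v, ?u) \<in> (arcs_ends ?T)\<^sup>*" unfolding ends by (meson rtrancl_mono subsetD subset_insertI)
    moreover have "(?u, ?z) \<in> arcs_ends ?T" unfolding ends by simp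
    ultimately show ?thesis by (rule rtrancl_into_rtrancl)
  qed (use that in auto)
  then have tree: "entering_tree ?T" using forest z_root unfolding entering_tree_iff by blast
  have "?T \<restriction> X = T"
    by (rule pre_digraph_eqI) (use T assms(5) in \<open>auto simp: compatible_def\<close>)
  then show ?thesis
    unfolding trees_between_def trees_around_def
    using sub tree assms(1,4,5) z_root T(7) by auto
qed

text \<open>An arc of a forest that leaves \<open>X\<close> starts at the root of the tree on
  \<open>X\<close>, hence extends that tree. The arcs of a splitting can thus be read off as
  crossing arcs.\<close>

lemma trees_between_entering_forest_iff:
  assumes "entering_forest F" "trees_on F X \<noteq> {}" "X \<inter> Y = {}"
  shows "trees_between F X Y \<noteq> {} \<longleftrightarrow> (\<exists>a \<in> arcs F. tail F a \<in> X \<and> head F a \<in> Y)"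
proof
  assume "trees_between F X Y \<noteq> {}"
  then show "\<exists>a \<in> arcs F. tail F a \<in> X \<and> head F a \<in> Y"
    using trees_between_decompose[OF _ assms(3)] by blast
next
  assume "\<exists>a \<in> arcs F. tail F a \<in> X \<and> head F a \<in> Y"
  then obtain a where a: "a \<in> arcs F" "tail F a \<in> X" "head F a \<in> Y" by blast
  obtain T where T: "T \<in> trees_on F X" using assms(2) by blast
  have hd: "head F a \<notin> X" using a assms(3) by blast
  show "trees_between F X Y \<noteq> {}"
    using trees_between_extend[OF T a(1) trees_on_leaving_arc_root[OF assms(1) T a(1,2) hd] a(3) hd]
    by blast
qed

section \<open>Exchanging the tree of a block\<close>

text \<open>A closed path that changes block projects to a nonempty closed walk in \<open>S\<close>;
  one that never changes block is closed within that block. Both are excluded.\<close>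

lemma acyclic_if_blockwise:
  assumes "partition_on V P" "R \<subseteq> V \<times> V" "acyclic S"
    and between: "\<And>Z W p q. Z \<in> P \<Longrightarrow> W \<in> P \<Longrightarrow> Z \<noteq> W \<Longrightarrow> p \<in> Z \<Longrightarrow> q \<in> W \<Longrightarrow>
      (p, q) \<in> R \<Longrightarrow> (Z, W) \<in> S"
    and within: "\<And>Z. Z \<in> P \<Longrightarrow> acyclic (R \<inter> Z \<times> Z)"
  shows "acyclic R"
proof (rule acyclicI, rule allI, rule notI)
  fix p assume p: "(p, p) \<in> R\<^sup>+"
  have block: "\<exists>Z \<in> P. v \<in> Z" if "v \<in> V" for v
    using that assms(1) by (auto simp: partition_on_def)
  have same: "Z = W" if "Z \<in> P" "W \<in> P" "v \<in> Z" "v \<in> W" for Z W v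
    using that assms(1) by (auto simp: partition_on_def disjoint_def)
  have "p \<in> V" using p assms(2) by (auto dest: tranclD)
  then obtain Z where Z: "Z \<in> P" "p \<in> Z" using block by blast
  \<comment> \<open>Induction invariant: the path from \<open>p\<close> has changed block, recorded
    by a nonempty \<open>S\<close>-walk, or it has stayed in \<open>Z\<close> throughout.\<close>
  have "(Z, W) \<in> S\<^sup>+ \<or> Z = W \<and> (p, q) \<in> (R \<inter> Z \<times> Z)\<^sup>+"
    if "(p, q) \<in> R\<^sup>+" "W \<in> P" "q \<in> W" for q W
    using that
  proof (induction arbitrary: W rule: trancl_induct)
    case (base q)
    then show ?case using between[OF Z(1) base(2) _ Z(2)] Z by blast
  next
    case (step q t)
    obtain U where U: "U \<in> P" "q \<in> U" using block step(2) assms(2) by blast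
    have IH: "(Z, U) \<in> S\<^sup>+ \<or> Z = U \<and> (p, q) \<in> (R \<inter> Z \<times> Z)\<^sup>+" using step.IH U by blast
    show ?case
    proof (cases "U = W")
      case True
      then have "(p, t) \<in> (R \<inter> Z \<times> Z)\<^sup>+" if "Z = U" "(p, q) \<in> (R \<inter> Z \<times> Z)\<^sup>+"
        using that U step by (auto intro: trancl_into_trancl)
      with IH True show ?thesis by blast
    next
      case False
      then have "(U, W) \<in> S" using between U step by blast
      with IH show ?thesis by (auto intro: trancl_into_trancl)
    qed
  qed
  from this[OF p Z] show False using assms(3) within[OF Z(1)] by (auto simp: acyclic_def)
qed

text \<open>All arcs with tail in \<open>X\<close> go, including the one that leaves
  \<open>X\<close>, since \<open>T\<close> brings its own. In the intended use the extra vertex of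
  \<open>T\<close> is already a vertex of \<open>F\<close>.\<close>

definition exchange :: "('v, 'a) pre_digraph \<Rightarrow> 'v set \<Rightarrow> ('v, 'a) pre_digraph \<Rightarrow> ('v, 'a) pre_digraph" where
  "exchange F X T = \<lparr>verts = verts F, arcs = {b \<in> arcs F. tail F b \<notin> X} \<union> arcs T,
     tail = tail F, head = head F\<rparr>"

lemma exchange_simps [simp]:
  "verts (exchange F X T) = verts F" "tail (exchange F X T) = tail F"
  "head (exchange F X T) = head F"
  "arcs (exchange F X T) = {b \<in> arcs F. tail F b \<notin> X} \<union> arcs T"
  by (auto simp: exchange_def)

text \<open>\<open>T\<close> is arbitrary here and later chosen of minimum weight. Acyclicity of the
  splitting expresses that \<open>F'\<close> is a forest, and \<open>a\<close> ensures that the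
  splitting of \<open>F\<close> already joins \<open>X\<close> to \<open>Y\<close>.\<close>

locale block_exchange =
  fixes G F T :: "('v, 'a) pre_digraph" and P :: "'v set set" and X Y :: "'v set" and a :: 'a
  assumes fin: "fin_digraph G" and part: "partition_on (verts G) P"
    and spanning: "spanning F G" and forest: "entering_forest F" and divisible: "tree_divisible F P"
    and acyclic_splitting: "acyclic (parcs (splitting F P))"
    and X: "X \<in> P" and Y: "Y \<in> P" and XY: "X \<noteq> Y"
    and a: "a \<in> arcs F" "tail F a \<in> X" "head F a \<in> Y"
    and T: "T \<in> trees_between G X Y"
begin

abbreviation "H \<equiv> exchange F X T"

lemma disjoint_blocks: "Z \<in> P \<Longrightarrow> W \<in> P \<Longrightarrow> Z \<noteq> W \<Longrightarrow> Z \<inter> W = {}"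
  using part by (auto simp: partition_on_def disjoint_def)

lemma ends [simp]: "tail F = tail G" "head F = head G"
  using spanning by (auto simp: spanning_def subgraph_def compatible_def)

lemma T_decompose:
  obtains t where "t \<in> arcs T" "tail G t \<in> X" "head G t \<in> Y"
    "\<And>b. b \<in> arcs T \<Longrightarrow> b = t \<or> b \<in> arcs (T \<restriction> X)"
    "T \<restriction> X \<in> trees_on G X" "is_root (T \<restriction> X) (tail G t)"
  using trees_between_decompose[OF T disjoint_blocks[OF X Y XY]] by (metis insert_iff)

lemma T_facts: "arcs T \<subseteq> arcs G" "tail T = tail G" "head T = head G" "entering_forest T"
  using T by (auto simp: trees_between_def trees_around_def subgraph_def compatible_def
      entering_tree_def)

lemma T_tail: "b \<in> arcs T \<Longrightarrow> tail G b \<in> X"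
  using T_decompose trees_onD(9) by metis

lemma tree_X: "F \<restriction> X \<in> trees_on F X"
proof -
  obtain U where "U \<in> trees_on F X" using divisible X by (auto simp: tree_divisible_def)
  then show ?thesis using trees_on_entering_forest[OF forest] by blast
qed

lemma root_X: "is_root (F \<restriction> X) (tail F a)"
  using trees_on_leaving_arc_root[OF forest tree_X a(1,2)] a(3) disjoint_blocks[OF X Y XY]
  by blast

text \<open>Every arc leaving \<open>X\<close> starts at the unique root of
  \<open>F \<restriction> X\<close>, whose only outgoing arc is \<open>a\<close>.\<close>

lemma F_arcs_from_X: "{b \<in> arcs F. tail F b \<in> X} = insert a (arcs (F \<restriction> X))"
proof (intro equalityI subsetI)
  fix b assume b: "b \<in> {b \<in> arcs F. tail F b \<in> X}"
  show "b \<in> insert a (arcs (F \<restriction> X))"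
  proof (cases "head F b \<in> X")
    case False
    then have "is_root (F \<restriction> X) (tail F b)"
      using trees_on_leaving_arc_root[OF forest tree_X, of b] b by blast
    then have "(tail F a, tail F b) \<in> (arcs_ends (F \<restriction> X))\<^sup>*"
      using trees_on_root_reached[OF tree_X] a by blast
    then have "tail F b = tail F a" using is_root_rtrancl[OF root_X] by blast
    then show ?thesis using entering_forest_arc_unique[OF forest, of b a] a b by simp
  qed (use b in auto)
qed (use a in auto)

lemma H_subgraph: "subgraph H G"
proof -
  interpret G: fin_digraph G by (rule fin)
  have "arcs H \<subseteq> arcs G" using spanning T_facts by (auto simp: spanning_def subgraph_def)
  then show ?thesis
    using spanning G.wellformed
    by (intro subgraphI G.wf_digraph) (auto simp: spanning_def compatible_def wf_digraph_def)
qed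

lemma H_arcs_outside: "Z \<in> P \<Longrightarrow> Z \<noteq> X \<Longrightarrow> b \<in> arcs H \<and> tail G b \<in> Z \<longleftrightarrow> b \<in> arcs F \<and> tail G b \<in> Z"
  using disjoint_blocks[OF X, of Z] T_tail by auto

text \<open>Arcs starting in other blocks are untouched. From \<open>X\<close>, both graphs send
  exactly one arc out, \<open>a\<close> in \<open>F\<close> and \<open>t\<close> in
  \<open>H\<close>, and both end in \<open>Y\<close>.\<close>

lemma H_crossing:
  assumes "Z \<in> P" "W \<in> P" "Z \<noteq> W"
  shows "(\<exists>b \<in> arcs H. tail G b \<in> Z \<and> head G b \<in> W) \<longleftrightarrow>
    (\<exists>b \<in> arcs F. tail G b \<in> Z \<and> head G b \<in> W)"
proof (cases "Z = X")
  case True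
  obtain t where t: "t \<in> arcs T" "tail G t \<in> X" "head G t \<in> Y"
    "\<And>b. b \<in> arcs T \<Longrightarrow> b = t \<or> b \<in> arcs (T \<restriction> X)"
    using T_decompose by blast
  have "(\<exists>b \<in> arcs H. tail G b \<in> X \<and> head G b \<in> W) \<longleftrightarrow> W = Y"
  proof
    assume "\<exists>b \<in> arcs H. tail G b \<in> X \<and> head G b \<in> W"
    then obtain b where b: "b \<in> arcs T" "head G b \<in> W" by auto
    then have "head G b \<notin> X" using disjoint_blocks[OF X assms(2)] assms(3) True by blast
    then have "b = t" using t(4)[OF b(1)] T_facts by auto
    then show "W = Y" using b t disjoint_blocks[OF assms(2) Y] by blast
  qed (use t in auto)
  moreover have "(\<exists>b \<in> arcs F. tail G b \<in> X \<and> head G b \<in> W) \<longleftrightarrow> W = Y"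
  proof
    assume "\<exists>b \<in> arcs F. tail G b \<in> X \<and> head G b \<in> W"
    then obtain b where b: "b \<in> arcs F" "tail G b \<in> X" "head G b \<in> W" by auto
    then have "head G b \<notin> X" using disjoint_blocks[OF X assms(2)] assms(3) True by blast
    then have "b = a" using b F_arcs_from_X by auto
    then show "W = Y" using b a disjoint_blocks[OF assms(2) Y] by auto
  qed (use a in auto)
  ultimately show ?thesis using True by blast
next
  case False
  then show ?thesis using H_arcs_outside[OF assms(1)] by blast
qed

lemma splitting_F_arc:
  assumes "Z \<in> P" "W \<in> P" "Z \<noteq> W"
  shows "(Z, W) \<in> parcs (splitting F P) \<longleftrightarrow> (\<exists>b \<in> arcs F. tail G b \<in> Z \<and> head G b \<in> W)"
  using trees_between_entering_forest_iff[OF forest _ disjoint_blocks[OF assms]] divisible assms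
  by (auto simp: splitting_def tree_divisible_def)

text \<open>Between blocks the arcs of \<open>H\<close> follow the acyclic splitting of
  \<open>F\<close>; within \<open>X\<close> they come from \<open>T\<close>, within any other block
  from \<open>F\<close>.\<close>

lemma H_acyclic: "acyclic (arcs_ends H)"
proof (rule acyclic_if_blockwise[OF part _ acyclic_splitting])
  interpret H: wf_digraph H using H_subgraph by blast
  show "arcs_ends H \<subseteq> verts G \<times> verts G"
    using H.adj_in_verts spanning by (auto simp: spanning_def)
  show "(Z, W) \<in> parcs (splitting F P)"
    if *: "Z \<in> P" "W \<in> P" "Z \<noteq> W" "p \<in> Z" "q \<in> W" "(p, q) \<in> arcs_ends H" for Z W p q
  proof -
    have "\<exists>b \<in> arcs H. tail G b \<in> Z \<and> head G b \<in> W" using *(4-6) by (auto simp: arcs_ends_conv)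
    then show ?thesis using splitting_F_arc[OF *(1-3)] H_crossing[OF *(1-3)] by simp
  qed
  show "acyclic (arcs_ends H \<inter> Z \<times> Z)" if Z: "Z \<in> P" for Z
  proof (cases "Z = X")
    case True
    have "arcs_ends H \<inter> X \<times> X \<subseteq> arcs_ends T"
      using T_facts by (auto simp: arcs_ends_conv)
    then show ?thesis using True entering_forest_acyclic[OF T_facts(4)] acyclic_subset by blast
  next
    case False
    then have "arcs_ends H \<inter> Z \<times> Z \<subseteq> arcs_ends F"
      using H_arcs_outside[OF Z] by (auto simp: arcs_ends_conv)
    then show ?thesis using entering_forest_acyclic[OF forest] acyclic_subset by blast
  qed
qed

text \<open>Arcs of \<open>T\<close> start in \<open>X\<close> and the kept arcs of \<open>F\<close>
  do not, so two arcs with a common tail come from the same forest.\<close>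

lemma H_forest: "entering_forest H"
proof (rule entering_forestI[OF _ _ H_acyclic])
  show "fin_digraph H" using fin H_subgraph by (rule fin_digraph.fin_digraph_subgraph)
  show "b = c" if "b \<in> arcs H" "c \<in> arcs H" "tail H b = tail H c" for b c
    using that T_tail[of b] T_tail[of c] T_facts(2) entering_forest_arc_unique[OF forest, of b c]
      entering_forest_arc_unique[OF T_facts(4), of b c]
    by auto
qed

lemma H_tree_divisible: "tree_divisible H P"
  unfolding tree_divisible_def
proof
  interpret H: wf_digraph H using H_subgraph by blast
  \<comment> \<open>\<open>K\<close> is \<open>G\<close> for the new tree on \<open>X\<close> and
    \<open>F\<close> for the retained trees on the other blocks.\<close>
  have sub: "U \<in> trees_on H D" if U: "U \<in> trees_on K D" "subgraph K G" "arcs U \<subseteq> arcs H" for U K D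
  proof -
    have "subgraph U G" using U trees_onD(1) subgraph_trans by blast
    then have "subgraph U H"
      using U(3) spanning by (auto simp: subgraph_def compatible_def spanning_def H.wf_digraph)
    with U(1) show ?thesis by (simp add: trees_on_def)
  qed
  fix Z assume Z: "Z \<in> P"
  show "trees_on H Z \<noteq> {}"
  proof (cases "Z = X")
    case True
    have "T \<restriction> X \<in> trees_on G X" using T_decompose by blast
    then have "T \<restriction> X \<in> trees_on H X"
      using fin by (intro sub) (auto simp: fin_digraph_def wf_digraph.subgraph_refl)
    with True show ?thesis by blast
  next
    case False
    obtain U where U: "U \<in> trees_on F Z" using divisible Z by (auto simp: tree_divisible_def)
    have "arcs U \<subseteq> arcs H"
      using trees_onD(6,9)[OF U] H_arcs_outside[OF Z False] by auto
    then show ?thesis using sub[OF U] spanning by (auto simp: spanning_def)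
  qed
qed

lemma H_splitting: "parcs (splitting H P) = parcs (splitting F P)"
proof -
  have "trees_between H Z W \<noteq> {} \<longleftrightarrow> trees_between F Z W \<noteq> {}"
    if "Z \<in> P" "W \<in> P" "Z \<noteq> W" for Z W
    using that H_crossing divisible H_tree_divisible disjoint_blocks
      trees_between_entering_forest_iff[OF forest, of Z W]
      trees_between_entering_forest_iff[OF H_forest, of Z W]
    by (auto simp: tree_divisible_def simp del: exchange_simps(4))
  then show ?thesis by (auto simp: splitting_def)
qed

text \<open>No vertex of \<open>X\<close> is a root of either graph: the root of its block tree has
  the crossing arc, the others have a tree arc. Elsewhere the outgoing arcs agree.\<close>

lemma H_roots: "is_root H v \<longleftrightarrow> is_root F v"
proof (cases "v \<in> X \<and> v \<in> verts G")
  case True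
  obtain t where t: "tail G t \<in> X" "t \<in> arcs T"
    "T \<restriction> X \<in> trees_on G X" "is_root (T \<restriction> X) (tail G t)"
    using T_decompose by blast
  have "\<exists>b \<in> arcs T. tail G b = v"
  proof (cases "is_root (T \<restriction> X) v")
    case True
    then have "v = tail G t"
      using trees_on_root_reached[OF t(3) True t(1)] is_root_rtrancl[OF t(4)] by blast
    then show ?thesis using t by blast
  next
    case False
    then obtain b where "b \<in> arcs (T \<restriction> X)" "tail G b = v"
      using trees_on_nonroot[OF t(3)] True by blast
    then show ?thesis by auto
  qed
  moreover have "\<exists>b \<in> arcs F. tail G b = v"
  proof (cases "is_root (F \<restriction> X) v")
    case True
    then have "v = tail F a"
      using trees_on_root_reached[OF tree_X True a(2)] is_root_rtrancl[OF root_X] by blast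
    then show ?thesis using a by auto
  next
    case False
    then obtain b where "b \<in> arcs (F \<restriction> X)" "tail F b = v"
      using trees_on_nonroot[OF tree_X] True by blast
    then show ?thesis by auto
  qed
  ultimately show ?thesis by (auto simp: is_root_def)
next
  case False
  then have "out_arcs H v = out_arcs F v" if "v \<in> verts G"
    using T_tail that by (auto simp: out_arcs_def)
  then show ?thesis using spanning by (auto simp: is_root_def spanning_def)
qed

lemma H_spanning_forest:
  assumes "F \<in> spanning_forests k G" shows "H \<in> spanning_forests k G"
  using assms H_forest H_subgraph H_roots
  by (auto simp: spanning_forests_def spanning_def card_components_entering_forest)

text \<open>Split both arc sets by whether the tail lies in \<open>X\<close>; the part outside is
  common and cancels.\<close>

lemma H_weight: "weight \<psi> H - weight \<psi> F = weight \<psi> T - (weight \<psi> (F \<restriction> X) + \<psi> a)"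
proof -
  interpret F: fin_digraph F using forest by (rule entering_forest_fin)
  interpret T: fin_digraph T using T_facts(4) by (rule entering_forest_fin)
  let ?O = "{b \<in> arcs F. tail F b \<notin> X}"
  have "weight \<psi> H = sum \<psi> ?O + weight \<psi> T"
    unfolding weight_def exchange_simps using T_tail by (intro sum.union_disjoint) auto
  moreover have "weight \<psi> F = sum \<psi> ?O + sum \<psi> {b \<in> arcs F. tail F b \<in> X}"
    unfolding weight_def by (subst sum.union_disjoint[symmetric]) (auto intro: sum.cong)
  moreover have "sum \<psi> {b \<in> arcs F. tail F b \<in> X} = weight \<psi> (F \<restriction> X) + \<psi> a"
    \<comment> \<open>The updated record merely carries the arc set, the only field that
      \<open>weight\<close> inspects.\<close>
    using weight_trees_between[OF tree_X root_X, of "F\<lparr>arcs := insert a (arcs (F \<restriction> X))\<rparr>" \<psi>]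
    unfolding F_arcs_from_X by (simp add: weight_def)
  ultimately show ?thesis by simp
qed

end

section \<open>Weights in the splitting and the inequality\<close>

lemma min_weight_between_entering_forest:
  assumes "entering_forest F" "T \<in> trees_on F X" "X \<inter> Y = {}"
    and a: "a \<in> arcs F" "tail F a \<in> X" "head F a \<in> Y"
  shows "min_weight_between \<psi> F X Y = weight \<psi> T + \<psi> a"
proof -
  have hd: "head F a \<notin> X" using a assms(3) by blast
  have root: "is_root T (tail F a)"
    using trees_on_leaving_arc_root[OF assms(1,2) a(1,2) hd] .
  \<comment> \<open>The tree of \<open>F\<close> on \<open>X\<close> is unique, and so is the arc of
    \<open>F\<close> leaving its root; hence the minimum ranges over a single value.\<close>
  have "weight \<psi> U = weight \<psi> T + \<psi> a" if U_in: "U \<in> trees_between F X Y" for U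
  proof -
    obtain b where b: "b \<in> arcs F" "arcs U = insert b (arcs (U \<restriction> X))"
      "U \<restriction> X \<in> trees_on F X" "is_root (U \<restriction> X) (tail F b)"
      using trees_between_decompose[OF U_in assms(3)] by metis
    have U: "U \<restriction> X = T" using trees_on_entering_forest_singleton[OF assms(1,2)] b(3) by blast
    have "(tail F a, tail F b) \<in> (arcs_ends T)\<^sup>*"
      using trees_on_root_reached[OF assms(2) _ a(2)] b(4) U by simp
    then have "tail F b = tail F a" using is_root_rtrancl[OF root] by blast
    then have "b = a" using entering_forest_arc_unique[OF assms(1)] a b by blast
    then show ?thesis using weight_trees_between[OF assms(2) root] b(2) unfolding U by blast
  qed
  moreover have "trees_between F X Y \<noteq> {}"
    using trees_between_extend[OF assms(2) a(1) root a(3) hd] by blast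
  ultimately have "weight \<psi> ` trees_between F X Y = {weight \<psi> T + \<psi> a}" by force
  then show ?thesis by (simp add: min_weight_between_def)
qed

theorem theorem2:
  fixes \<Psi> :: "'v pair_pre_digraph"
    and \<psi> :: "('v \<times> 'v) weight_fun"
    and P :: "'v set set"
    and k :: nat
    and F' :: "('v set, 'v set \<times> 'v set) pre_digraph"
    and f' :: "('v set \<times> 'v set) weight_fun"
    and F :: "('v, 'v \<times> 'v) pre_digraph"
    and X Y :: "'v set"
    and x y :: 'v
  assumes "pair_fin_digraph \<Psi>"
    and "partition_on (pverts \<Psi>) P"
    and "tree_divisible (with_proj \<Psi>) P"
    and "F' \<in> spanning_forests k (with_proj (splitting (with_proj \<Psi>) P))"
    and "\<And>a. a \<in> arcs F' \<Longrightarrow> f' a = splitting_weight \<psi> (with_proj \<Psi>) a"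
    and "minimal_principal \<psi> (with_proj \<Psi>) P k F' F"
    and "X \<in> P"
    and "\<And>v. v \<in> X \<Longrightarrow> \<not> is_root F v"
    and "(x, y) \<in> arcs F" and "x \<in> X" and "y \<notin> X"
    and "Y \<in> P" and "y \<in> Y"
  shows "f' (X, Y) = splitting_weight \<psi> (with_proj \<Psi>) (X, Y) \<and>
         splitting_weight \<psi> (with_proj \<Psi>) (X, Y) \<ge> \<psi> (x, y) \<and>
         \<psi> (x, y) = splitting_weight \<psi> F (X, Y) \<and>
         (F \<restriction> X \<in> min_trees_on \<psi> (with_proj \<Psi>) X \<longrightarrow>
            splitting_weight \<psi> (with_proj \<Psi>) (X, Y) = \<psi> (x, y))"
proof -
  let ?G = "with_proj \<Psi>"
  interpret G: pair_fin_digraph \<Psi> by fact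
  have finG: "fin_digraph ?G" by unfold_locales
  have F: "F \<in> spanning_forests k ?G" "tree_divisible F P" "arcs F' = parcs (splitting F P)"
    and F_min: "\<And>H. principal ?G P k F' H \<Longrightarrow> weight \<psi> F \<le> weight \<psi> H"
    using assms(6) by (auto simp: minimal_principal_def principal_def)
  then have span: "spanning F ?G" and forest: "entering_forest F"
    by (auto simp: spanning_forests_def)
  have sub: "subgraph F ?G" and th: "tail F = fst" "head F = snd"
    using span by (auto simp: spanning_def subgraph_def compatible_def)
  have XY: "X \<noteq> Y" "X \<inter> Y = {}"
    using assms(2,7,11,12,13) by (auto simp: partition_on_def disjoint_def)
  obtain T0 where "T0 \<in> trees_on F X" using F(2) assms(7) by (auto simp: tree_divisible_def)
  then have T0: "F \<restriction> X \<in> trees_on F X" using trees_on_entering_forest[OF forest] by blast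
  \<comment> \<open>The arcs of \<open>F'\<close> are pairs with the projections as ends, so
    acyclicity of \<open>F'\<close> is acyclicity of its arc set, which is that of the splitting of
    \<open>F\<close>.\<close>
  have "entering_forest F'" "arcs_ends F' = arcs F'"
    using assms(4) by (auto simp: spanning_forests_def spanning_def subgraph_def compatible_def
        arcs_ends_conv)
  then have acyclic_F': "acyclic (parcs (splitting F P))"
    using entering_forest_acyclic F(3) by metis
  have arc: "(x, y) \<in> arcs F" "tail F (x, y) \<in> X" "head F (x, y) \<in> Y"
    using assms th by auto
  have "\<exists>a \<in> arcs F. tail F a \<in> X \<and> head F a \<in> Y" using arc by blast
  then have between_F: "trees_between F X Y \<noteq> {}"
    using trees_between_entering_forest_iff[OF forest _ XY(2)] T0 by blast
  then have "(X, Y) \<in> arcs F'"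
    using F(3) assms(7,12) XY by (simp add: splitting_def)
  then have f': "f' (X, Y) = splitting_weight \<psi> ?G (X, Y)" using assms(5) by blast
  have on_F: "min_weight_on \<psi> F X = weight \<psi> (F \<restriction> X)"
    using trees_on_entering_forest_singleton[OF forest T0] by (simp add: min_weight_on_def)
  have between_F_weight: "min_weight_between \<psi> F X Y = weight \<psi> (F \<restriction> X) + \<psi> (x, y)"
    using min_weight_between_entering_forest[OF forest T0 XY(2) arc] .
  have on_G: "min_weight_on \<psi> ?G X \<le> weight \<psi> (F \<restriction> X)"
    unfolding min_weight_on_def
    using T0 trees_on_mono[OF sub] finite_trees_on[OF finG] by (intro Min_le) auto
  \<comment> \<open>A larger set of trees has a smaller minimum. This upper bound serves the
    equality case.\<close>
  have "min_weight_between \<psi> ?G X Y \<le> min_weight_between \<psi> F X Y"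
    unfolding min_weight_between_def
    using between_F trees_between_mono[OF sub] finite_trees_between[OF finG]
    by (intro Min_antimono image_mono) auto
  then have between_le: "min_weight_between \<psi> ?G X Y \<le> weight \<psi> (F \<restriction> X) + \<psi> (x, y)"
    using between_F_weight by simp
  \<comment> \<open>The tree to be exchanged in attains the minimum; the trees of \<open>F\<close>
    show that there are candidates.\<close>
  have "min_weight_between \<psi> ?G X Y \<in> weight \<psi> ` trees_between ?G X Y"
    unfolding min_weight_between_def
    using between_F trees_between_mono[OF sub, of X Y] finite_trees_between[OF finG]
    by (intro Min_in) auto
  then obtain T where T: "T \<in> trees_between ?G X Y" "weight \<psi> T = min_weight_between \<psi> ?G X Y"
    by auto
  interpret E: block_exchange ?G F T P X Y "(x, y)"
    by unfold_locales (use finG assms span forest F acyclic_F' XY arc T in auto)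
  have "principal ?G P k F' E.H"
    using E.H_spanning_forest[OF F(1)] E.H_tree_divisible E.H_splitting F(3)
    by (simp add: principal_def)
  then have "weight \<psi> F \<le> weight \<psi> E.H" by (rule F_min)
  \<comment> \<open>\<open>E.H\<close> competes with \<open>F\<close>, so the weight difference
    given by \<open>E.H_weight\<close> is nonnegative.\<close>
  then have between_ge: "weight \<psi> (F \<restriction> X) + \<psi> (x, y) \<le> min_weight_between \<psi> ?G X Y"
    using E.H_weight[of \<psi>] T(2) by simp
  have "splitting_weight \<psi> ?G (X, Y) = \<psi> (x, y)" if "F \<restriction> X \<in> min_trees_on \<psi> ?G X"
    using that between_le between_ge by (simp add: min_trees_on_def splitting_weight_def)
  \<comment> \<open>Subtracting \<open>on_G\<close> from \<open>between_ge\<close> gives the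
    inequality; within \<open>F\<close> the two minima differ by exactly
    \<open>\<psi> (x, y)\<close>.\<close>
  with f' on_F between_F_weight on_G between_ge show ?thesis
    by (simp add: splitting_weight_def)
qed

end
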